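(* Let $T\in \mathcal{B}_A(\mathcal{H})$. Then $$d\omega_A(T) \leq \sqrt{\|T\|_A\,\max\left\{\omega_A(T), \omega_A(T^\sharp T)\right\}\sqrt{1 + \|T\|_A^2 + 2\,\omega_A(T)}}.$$
   Context: $\mathcal{H}$ is a complex Hilbert space with inner product $\langle\cdot\mid\cdot\rangle$, $\mathcal{B}(\mathcal{H})$ is the algebra of bounded linear operators on $\mathcal{H}$, and $A\in\mathcal{B}(\mathcal{H})$ is a fixed nonzero positive (semidefinite) operator. Put $\langle x\mid y\rangle_A=\langle Ax\mid y\rangle$ and $\|x\|_A=\langle x\mid x\rangle_A^{1/2}$. $\mathcal{B}_A(\mathcal{H})=\{T\in\mathcal{B}(\mathcal{H}) : \mathcal{R}(T^*A)\subseteq\mathcal{R}(A)\}$, where $\mathcal{R}$ denotes range; for $T\in\mathcal{B}_A(\mathcal{H})$, $T^\sharp$ denotes the unique $X\in\mathcal{B}(\mathcal{H})$ with $AX=T^*A$ and $\mathcal{R}(X)\subseteq\overline{\mathcal{R}(A)}$ (so $\langle Tx\mid y\rangle_A=\langle x\mid T^\sharp y\rangle_A$). For $T\in\mathcal{B}_A(\mathcal{H})$: $\|T\|_A=\sup\{\|Tx\|_A : \|x\|_A=1\}$, $\omega_A(T)=\sup\{|\langle Tx\mid x\rangle_A| : \|x\|_A=1\}$, and the $A$-Davis-Wielandt radius is $d\omega_A(T)=\sup\{\sqrt{|\langle Tx\mid x\rangle_A|^2+\|Tx\|_A^4} : \|x\|_A=1\}$. All of these are finite. *)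

theory Defs
  imports "HOL-Analysis.Analysis"
begin

text \<open>The inner product is linear in the first argument. Real scalar multiplication, norm and
  topology are inherited from \<^class>\<open>real_normed_vector\<close> and tied to the complex structure by
  \<open>scaleR_scaleC\<close> and \<open>cinner_same\<close>; the latter also yields positive definiteness.\<close>

class complex_inner = real_normed_vector +
  fixes scaleC :: "complex \<Rightarrow> 'a \<Rightarrow> 'a"  (infixr \<open>*\<^sub>C\<close> 75)
    and cinner :: "'a \<Rightarrow> 'a \<Rightarrow> complex"
  assumes scaleC_add_right: "c *\<^sub>C (x + y) = c *\<^sub>C x + c *\<^sub>C y"
    and scaleC_add_left: "(c + d) *\<^sub>C x = c *\<^sub>C x + d *\<^sub>C x"
    and scaleC_scaleC: "c *\<^sub>C (d *\<^sub>C x) = (c * d) *\<^sub>C x"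
    and scaleR_scaleC: "r *\<^sub>R x = complex_of_real r *\<^sub>C x"
    and cinner_commute: "cinner x y = cnj (cinner y x)"
    and cinner_add_left: "cinner (x + y) z = cinner x z + cinner y z"
    and cinner_scaleC_left: "cinner (c *\<^sub>C x) y = c * cinner x y"
    and cinner_same: "cinner x x = complex_of_real ((norm x)\<^sup>2)"

class chilbert_space = complex_inner + complete_space

instantiation complex :: chilbert_space
begin

definition scaleC_complex :: "complex \<Rightarrow> complex \<Rightarrow> complex" where
  "scaleC_complex c x = c * x"

definition cinner_complex :: "complex \<Rightarrow> complex \<Rightarrow> complex" where
  "cinner_complex x y = x * cnj y"

instance
  by standard
    (simp_all add: scaleC_complex_def cinner_complex_def algebra_simps scaleR_conv_of_real
      complex_norm_square flip: of_real_power)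

end

definition bounded_clinear :: "('a::complex_inner \<Rightarrow> 'a) \<Rightarrow> bool" where
  "bounded_clinear T \<longleftrightarrow> bounded_linear T \<and> (\<forall>c x. T (c *\<^sub>C x) = c *\<^sub>C T x)"

text \<open>For bounded \<open>T\<close> on a Hilbert space, existence and uniqueness of the adjoint are the
  Riesz representation theorem.\<close>

definition cadjoint :: "('a::chilbert_space \<Rightarrow> 'a) \<Rightarrow> 'a \<Rightarrow> 'a" where
  "cadjoint T =
    (THE S. bounded_clinear S \<and> (\<forall>x y. cinner (T x) y = cinner x (S y)))"

definition positive_operator :: "('a::complex_inner \<Rightarrow> 'a) \<Rightarrow> bool" where
  "positive_operator A \<longleftrightarrow> bounded_clinear A \<and> (\<forall>x. cinner (A x) x \<in> \<real>\<^sub>\<ge>\<^sub>0)"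

definition A_inner :: "('a::complex_inner \<Rightarrow> 'a) \<Rightarrow> 'a \<Rightarrow> 'a \<Rightarrow> complex" where
  "A_inner A x y = cinner (A x) y"

definition A_norm :: "('a::complex_inner \<Rightarrow> 'a) \<Rightarrow> 'a \<Rightarrow> real" where
  "A_norm A x = sqrt (Re (A_inner A x x))"

definition A_adjointable :: "('a::chilbert_space \<Rightarrow> 'a) \<Rightarrow> ('a \<Rightarrow> 'a) set" where
  "A_adjointable A = {T. bounded_clinear T \<and> range (cadjoint T \<circ> A) \<subseteq> range A}"

text \<open>For \<open>T \<in> A_adjointable A\<close>, existence and uniqueness of \<open>A_sharp A T\<close> are Douglas'
  range inclusion theorem.\<close>

definition A_sharp :: "('a::chilbert_space \<Rightarrow> 'a) \<Rightarrow> ('a \<Rightarrow> 'a) \<Rightarrow> 'a \<Rightarrow> 'a" where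
  "A_sharp A T =
    (THE X. bounded_clinear X \<and> A \<circ> X = cadjoint T \<circ> A \<and> range X \<subseteq> closure (range A))"

text \<open>The suprema are taken in \<^typ>\<open>real\<close>: for positive \<open>A \<noteq> 0\<close> and \<open>T \<in> A_adjointable A\<close>
  they range over nonempty sets that are bounded above.\<close>

definition A_opnorm :: "('a::complex_inner \<Rightarrow> 'a) \<Rightarrow> ('a \<Rightarrow> 'a) \<Rightarrow> real" where
  "A_opnorm A T = (SUP x\<in>{x. A_norm A x = 1}. A_norm A (T x))"

definition A_numerical_radius :: "('a::complex_inner \<Rightarrow> 'a) \<Rightarrow> ('a \<Rightarrow> 'a) \<Rightarrow> real" where
  "A_numerical_radius A T = (SUP x\<in>{x. A_norm A x = 1}. cmod (A_inner A (T x) x))"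

definition A_DW_radius :: "('a::complex_inner \<Rightarrow> 'a) \<Rightarrow> ('a \<Rightarrow> 'a) \<Rightarrow> real" where
  "A_DW_radius A T =
    (SUP x\<in>{x. A_norm A x = 1}. sqrt ((cmod (A_inner A (T x) x))\<^sup>2 + (A_norm A (T x)) ^ 4))"

end

theory Submission
  imports Defs
begin

text \<open>With \<open>u = T x\<close>, \<open>y = x\<close>, \<open>z = T x\<close>, the quantity
  \<open>|\<langle>T x, x\<rangle>|\<^sup>2 + \<parallel>T x\<parallel> ^ 4\<close> is \<open>|\<langle>u, y\<rangle>|\<^sup>2 + |\<langle>u, z\<rangle>|\<^sup>2 = \<langle>u, \<alpha> y + \<beta> z\<rangle>\<close> for
  \<open>\<alpha> = \<langle>u, y\<rangle>\<close>, \<open>\<beta> = \<langle>u, z\<rangle>\<close> (all in the \<open>A\<close>-semi-inner product), and Cauchy--Schwarz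
  followed by expanding \<open>\<parallel>\<alpha> y + \<beta> z\<parallel>\<^sup>2\<close> gives the bound pointwise. The remaining work is
  to show that the suprema are of bounded sets: \<open>A_sharp A T\<close> exists by the uniform
  boundedness principle, and \<open>A_sharp A T \<circ> T\<close>, being symmetric for the semi-inner
  product, is bounded for the seminorm by an argument of Krein.\<close>

section \<open>Complex inner product spaces\<close>

lemma cinner_add_right: "cinner x (y + z) = cinner x y + cinner x z"
  by (metis cinner_add_left cinner_commute complex_cnj_add)

lemma cinner_scaleC_right: "cinner x (c *\<^sub>C y) = cnj c * cinner x y"
  by (metis cinner_commute cinner_scaleC_left complex_cnj_mult)

lemma cinner_zero_left [simp]: "cinner 0 y = 0"
  using cinner_add_left[of 0 0 y] by simp

lemma cinner_zero_right [simp]: "cinner x 0 = 0"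
  using cinner_add_right[of x 0 0] by simp

lemma cinner_diff_left: "cinner (x - y) z = cinner x z - cinner y z"
  using cinner_add_left[of "x - y" y z] by simp

lemma cinner_diff_right: "cinner x (y - z) = cinner x y - cinner x z"
  using cinner_add_right[of x "y - z" z] by simp

lemma cinner_scaleR_left: "cinner (r *\<^sub>R x) y = of_real r * cinner x y"
  by (simp add: scaleR_scaleC cinner_scaleC_left)

lemma cinner_scaleR_right: "cinner x (r *\<^sub>R y) = of_real r * cinner x y"
  by (simp add: scaleR_scaleC cinner_scaleC_right)

lemma cinner_eq_zero_iff [simp]: "cinner x x = 0 \<longleftrightarrow> x = 0"
  by (simp add: cinner_same)

lemma cinner_right_eqI:
  assumes "\<And>x. cinner x y = cinner x z"
  shows "y = z"
proof -
  have "cinner (y - z) (y - z) = 0"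
    using assms by (simp add: cinner_diff_right)
  then show ?thesis by simp
qed

lemma cinner_left_eqI:
  assumes "\<And>y. cinner x y = cinner z y"
  shows "x = z"
  by (rule cinner_right_eqI) (metis assms cinner_commute)

text \<open>The class axioms tie \<open>norm\<close> directly to real scalars only; complex
  homogeneity is recovered through \<open>cinner_same\<close>.\<close>

lemma norm_scaleC: "norm (c *\<^sub>C (x::'a::complex_inner)) = cmod c * norm x"
proof -
  have "complex_of_real ((norm (c *\<^sub>C x))\<^sup>2) = c * cnj c * of_real ((norm x)\<^sup>2)"
    by (simp only: cinner_same[symmetric] cinner_scaleC_left cinner_scaleC_right mult_ac)
  also have "\<dots> = of_real ((cmod c * norm x)\<^sup>2)"
    by (simp only: of_real_mult of_real_power power_mult_distrib flip: complex_norm_square)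
  finally have "(norm (c *\<^sub>C x))\<^sup>2 = (cmod c * norm x)\<^sup>2"
    using of_real_eq_iff by blast
  then show ?thesis by (simp add: power2_eq_iff_nonneg)
qed

lemma norm_add_sq:
  "(norm (x + y :: 'a::complex_inner))\<^sup>2 = (norm x)\<^sup>2 + 2 * Re (cinner x y) + (norm y)\<^sup>2"
proof -
  have "complex_of_real ((norm (x + y))\<^sup>2)
      = of_real ((norm x)\<^sup>2) + (cinner x y + cnj (cinner x y)) + of_real ((norm y)\<^sup>2)"
    by (simp only: cinner_same[symmetric] cinner_add_left cinner_add_right
        cinner_commute[of y x] add_ac)
  then have "Re (complex_of_real ((norm (x + y))\<^sup>2))
      = Re (of_real ((norm x)\<^sup>2) + (cinner x y + cnj (cinner x y)) + of_real ((norm y)\<^sup>2))"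
    by (rule arg_cong)
  then show ?thesis by simp
qed

lemma norm_diff_sq:
  "(norm (x - y :: 'a::complex_inner))\<^sup>2 = (norm x)\<^sup>2 - 2 * Re (cinner x y) + (norm y)\<^sup>2"
  using norm_add_sq[of x "- y"] cinner_diff_right[of x 0 y] by simp


section \<open>Positive operators and their semi-inner products\<close>

lemma bounded_clinearI:
  assumes "\<And>x y. T (x + y) = T x + T y" "\<And>c x. T (c *\<^sub>C x) = c *\<^sub>C T x"
    and "\<And>x. norm (T x) \<le> K * norm x"
  shows "bounded_clinear T"
  unfolding bounded_clinear_def
proof
  show "bounded_linear T"
    by (rule bounded_linear_intro[where K = K])
      (use assms in \<open>auto simp: scaleR_scaleC mult.commute\<close>)
qed (use assms in auto)

lemma bounded_clinearD:
  assumes "bounded_clinear T"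
  shows "bounded_linear T" "T (x + y) = T x + T y" "T (x - y) = T x - T y"
    "T (c *\<^sub>C x) = c *\<^sub>C T x" "T (r *\<^sub>R x) = r *\<^sub>R T x" "T 0 = 0"
proof -
  show bl: "bounded_linear T"
    using assms by (simp add: bounded_clinear_def)
  show "T (x + y) = T x + T y" "T (x - y) = T x - T y" "T (r *\<^sub>R x) = r *\<^sub>R T x" "T 0 = 0"
    using bl by (simp_all add: linear_simps)
  show "T (c *\<^sub>C x) = c *\<^sub>C T x"
    using assms by (simp add: bounded_clinear_def)
qed

lemma bounded_clinear_compose:
  "bounded_clinear S \<Longrightarrow> bounded_clinear T \<Longrightarrow> bounded_clinear (S \<circ> T)"
  unfolding bounded_clinear_def comp_def by (auto intro: bounded_linear_compose)

lemma positive_operatorD: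
  assumes "positive_operator A"
  shows "bounded_clinear A" "0 \<le> Re (cinner (A x) x)" "Im (cinner (A x) x) = 0"
  using assms by (auto simp: positive_operator_def complex_nonneg_Reals_iff)

text \<open>The trivial weight, for which \<open>A_inner\<close> is \<open>cinner\<close>:
  Cauchy--Schwarz for \<open>cinner\<close> becomes an instance of the weighted version.\<close>

lemma positive_operator_id: "positive_operator (\<lambda>x. x)"
  by (auto simp: positive_operator_def bounded_clinear_def cinner_same complex_nonneg_Reals_iff
      simp flip: of_real_power)

section \<open>Sesquilinearity and the seminorm\<close>

lemma A_inner_add_left:
  "positive_operator A \<Longrightarrow> A_inner A (x + y) z = A_inner A x z + A_inner A y z"
  by (simp add: A_inner_def bounded_clinearD[OF positive_operatorD(1)] cinner_add_left)

lemma A_inner_add_right: "A_inner A x (y + z) = A_inner A x y + A_inner A x z"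
  by (simp add: A_inner_def cinner_add_right)

lemma A_inner_scaleC_left:
  "positive_operator A \<Longrightarrow> A_inner A (c *\<^sub>C x) y = c * A_inner A x y"
  by (simp add: A_inner_def bounded_clinearD[OF positive_operatorD(1)] cinner_scaleC_left)

lemma A_inner_scaleC_right: "A_inner A x (c *\<^sub>C y) = cnj c * A_inner A x y"
  by (simp add: A_inner_def cinner_scaleC_right)

lemma Im_A_inner_same: "positive_operator A \<Longrightarrow> Im (A_inner A x x) = 0"
  by (simp add: A_inner_def positive_operatorD)

text \<open>Polarization: diagonal values are real, so expanding at \<open>x + y\<close> compares
  the imaginary parts and expanding at \<open>x + \<i> *\<^sub>C y\<close> the real parts.\<close>

lemma A_inner_commute:
  assumes A: "positive_operator A"
  shows "A_inner A x y = cnj (A_inner A y x)"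
proof -
  note expand = A_inner_add_left[OF A] A_inner_add_right A_inner_scaleC_left[OF A]
    A_inner_scaleC_right
  have "Im (A_inner A x y + A_inner A y x) = 0"
    using Im_A_inner_same[OF A, of "x + y"] Im_A_inner_same[OF A, of x]
      Im_A_inner_same[OF A, of y] by (simp add: expand)
  moreover have "Re (A_inner A y x) - Re (A_inner A x y) = 0"
    using Im_A_inner_same[OF A, of "x + \<i> *\<^sub>C y"] Im_A_inner_same[OF A, of x]
      Im_A_inner_same[OF A, of y] by (simp add: expand)
  ultimately show ?thesis by (simp add: complex_eq_iff)
qed

lemma positive_operator_selfadjoint:
  assumes "positive_operator A"
  shows "cinner (A x) y = cinner x (A y)"
  using A_inner_commute[OF assms, of x y] cinner_commute[of x "A y"] by (simp add: A_inner_def)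

lemma A_norm_nonneg [simp]: "positive_operator A \<Longrightarrow> 0 \<le> A_norm A x"
  by (simp add: A_norm_def A_inner_def positive_operatorD)

lemma A_norm_sq: "positive_operator A \<Longrightarrow> (A_norm A x)\<^sup>2 = Re (A_inner A x x)"
  by (simp add: A_norm_def A_inner_def positive_operatorD)

lemma A_inner_same: "positive_operator A \<Longrightarrow> A_inner A x x = of_real ((A_norm A x)\<^sup>2)"
  by (simp add: complex_eq_iff A_norm_sq Im_A_inner_same)

lemma A_norm_add_sq:
  assumes A: "positive_operator A"
  shows "(A_norm A (x + y))\<^sup>2 = (A_norm A x)\<^sup>2 + 2 * Re (A_inner A x y) + (A_norm A y)\<^sup>2"
  using A_inner_commute[OF A, of y x]
  by (simp add: A_norm_sq[OF A] A_inner_add_left[OF A] A_inner_add_right)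

lemma A_norm_scaleC:
  assumes A: "positive_operator A"
  shows "A_norm A (c *\<^sub>C x) = cmod c * A_norm A x"
proof -
  have "complex_of_real ((A_norm A (c *\<^sub>C x))\<^sup>2) = c * cnj c * of_real ((A_norm A x)\<^sup>2)"
    by (simp only: A_inner_same[OF A, symmetric] A_inner_scaleC_left[OF A] A_inner_scaleC_right
        mult_ac)
  also have "\<dots> = of_real ((cmod c * A_norm A x)\<^sup>2)"
    by (simp only: of_real_mult of_real_power power_mult_distrib flip: complex_norm_square)
  finally have "(A_norm A (c *\<^sub>C x))\<^sup>2 = (cmod c * A_norm A x)\<^sup>2"
    using of_real_eq_iff by blast
  then show ?thesis using A by (simp add: power2_eq_iff_nonneg)
qed

text \<open>Evaluation at the minimiser \<open>t = - b / c\<close>. The degenerate case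
  \<open>c = 0\<close> is covered because the seminorm of a nonzero vector may vanish.\<close>

lemma nonneg_quadratic_discriminant:
  fixes a b c :: real
  assumes nonneg: "\<And>t. 0 \<le> a + 2 * b * t + c * t\<^sup>2" and c: "0 \<le> c"
  shows "b\<^sup>2 \<le> a * c"
proof (cases "c = 0")
  case True
  have "b = 0"
  proof (rule ccontr)
    assume "b \<noteq> 0"
    then show False
      \<comment> \<open>At this \<open>t\<close> the affine function takes the value -1.\<close>
      using nonneg[of "- (a + 1) / (2 * b)"] True by (simp add: field_simps)
  qed
  then show ?thesis using True by simp
next
  case False
  then have "c > 0" using c by simp
  have "0 \<le> a + 2 * b * (- b / c) + c * (- b / c)\<^sup>2" by (rule nonneg)
  also have "\<dots> = a - b\<^sup>2 / c" using \<open>c > 0\<close> by (simp add: field_simps power2_eq_square)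
  finally show ?thesis using \<open>c > 0\<close> by (simp add: field_simps)
qed

text \<open>Rotating \<open>y\<close> by the phase \<open>c\<close> makes the inner product real and
  nonnegative; the squared seminorm of \<open>x\<close> plus a real multiple \<open>t\<close> of the
  rotated \<open>y\<close> is then a nonnegative quadratic in \<open>t\<close>.\<close>

lemma A_inner_Cauchy_Schwarz:
  assumes A: "positive_operator A"
  shows "cmod (A_inner A x y) \<le> A_norm A x * A_norm A y"
proof (cases "A_inner A x y = 0")
  case True
  then show ?thesis using A by simp
next
  case False
  define c where "c = sgn (A_inner A x y)"
  have c: "cmod c = 1" using False by (simp add: c_def norm_sgn)
  have ip: "cnj c * A_inner A x y = of_real (cmod (A_inner A x y))"
    using False by (simp add: c_def sgn_div_norm scaleR_conv_of_real complex_norm_square[symmetric]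
        field_simps power2_eq_square)
  have "0 \<le> (A_norm A x)\<^sup>2 + 2 * cmod (A_inner A x y) * t + (A_norm A y)\<^sup>2 * t\<^sup>2" for t
  proof -
    have "0 \<le> (A_norm A (x + (of_real t * c) *\<^sub>C y))\<^sup>2" by simp
    also have "\<dots> = (A_norm A x)\<^sup>2 + 2 * cmod (A_inner A x y) * t + (A_norm A y)\<^sup>2 * t\<^sup>2"
      using c by (simp add: A_norm_add_sq[OF A] A_norm_scaleC[OF A] A_inner_scaleC_right ip
          norm_mult power_mult_distrib mult.assoc)
    finally show ?thesis .
  qed
  then have "(cmod (A_inner A x y))\<^sup>2 \<le> (A_norm A x * A_norm A y)\<^sup>2"
    unfolding power_mult_distrib by (rule nonneg_quadratic_discriminant) simp
  then show ?thesis by (rule power2_le_imp_le) (simp add: A)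
qed

lemma cinner_Cauchy_Schwarz: "cmod (cinner x y) \<le> norm x * norm y"
  using A_inner_Cauchy_Schwarz[OF positive_operator_id, of x y]
  by (simp add: A_norm_def A_inner_def cinner_same)

lemma bounded_linear_cinner_left: "bounded_linear (\<lambda>x. cinner x y)"
  by (rule bounded_linear_intro[where K = "norm y"])
    (auto simp: cinner_add_left cinner_scaleR_left scaleR_conv_of_real cinner_Cauchy_Schwarz)

lemma bounded_linear_cinner_right: "bounded_linear (\<lambda>y. cinner x y)"
  by (rule bounded_linear_intro[where K = "norm x"])
    (auto simp: cinner_add_right cinner_scaleR_right scaleR_conv_of_real
      intro: order_trans[OF cinner_Cauchy_Schwarz])

lemma A_norm_le_norm:
  assumes A: "positive_operator A"
  obtains C where "0 \<le> C" "\<And>x. A_norm A x \<le> C * norm x"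
proof -
  obtain K where K: "0 \<le> K" "\<And>x. norm (A x) \<le> norm x * K"
    using bounded_linear.nonneg_bounded[OF bounded_clinearD(1)[OF positive_operatorD(1)[OF A]]]
    by blast
  have "A_norm A x \<le> sqrt K * norm x" for x
  proof -
    have "Re (A_inner A x x) \<le> norm (A x) * norm x"
      unfolding A_inner_def using complex_Re_le_cmod cinner_Cauchy_Schwarz order_trans by blast
    also have "\<dots> \<le> (norm x * K) * norm x" using K by (intro mult_right_mono) auto
    finally have "A_norm A x \<le> sqrt (K * (norm x)\<^sup>2)"
      by (simp add: A_norm_def power2_eq_square mult_ac)
    then show ?thesis by (simp add: real_sqrt_mult)
  qed
  then show ?thesis using that[of "sqrt K"] K by auto
qed


section \<open>Uniform boundedness, projections and adjoints\<close>

text \<open>Baire category: the closed sets \<open>E n\<close>, on which all of \<open>F\<close> is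
  bounded by \<open>n\<close>, cover the space, so one of them contains a ball; differences of
  values on it bound \<open>F\<close> near 0.\<close>

lemma uniform_boundedness:
  fixes F :: "('a::{real_normed_vector,complete_space} \<Rightarrow> 'b::real_normed_vector) set"
  assumes lin: "\<And>f. f \<in> F \<Longrightarrow> bounded_linear f"
    and ptwise: "\<And>x. \<exists>K. \<forall>f\<in>F. norm (f x) \<le> K"
  obtains K where "\<And>f x. f \<in> F \<Longrightarrow> norm (f x) \<le> K * norm x"
proof -
  define E where "E = (\<lambda>n::nat. \<Inter>f\<in>F. {x. norm (f x) \<le> real n})"
  have clo: "closed (E n)" for n
    unfolding E_def
    by (intro closed_INT ballI closed_Collect_le continuous_on_norm continuous_on_const
        linear_continuous_on lin)
  have cover: "\<Union> (range E) = UNIV"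
  proof -
    have "\<exists>n. x \<in> E n" for x
    proof -
      obtain K where K: "\<forall>f\<in>F. norm (f x) \<le> K" using ptwise by blast
      obtain n where "K \<le> real n" using real_arch_simple by blast
      with K have "x \<in> E n" by (force simp: E_def)
      then show ?thesis ..
    qed
    then show ?thesis by blast
  qed
  have "\<exists>n. interior (E n) \<noteq> {}"
  proof (rule ccontr)
    assume "\<not> ?thesis"
    then have "euclidean interior_of \<Union> (range E) = {}"
      by (intro Baire_category_alt disjI1 completely_metrizable_space_euclidean)
        (use clo in auto)
    then show False by (simp add: cover)
  qed
  then obtain n x0 e where e: "e > 0" "cball x0 e \<subseteq> E n"
    by (metis ex_in_conv mem_interior_cball)
  have "norm (f x) \<le> (2 * real n / e) * norm x" if f: "f \<in> F" for f x
  proof (cases "x = 0")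
    case True
    then show ?thesis using lin[OF f] by (simp add: linear_simps)
  next
    case False
    interpret f: bounded_linear f by (rule lin[OF f])
    \<comment> \<open>\<open>y\<close> has norm exactly \<open>e\<close>, so \<open>x0 + y\<close>
      is on the boundary of the closed ball.\<close>
    define y where "y = (e / norm x) *\<^sub>R x"
    have "x0 + y \<in> E n" "x0 \<in> E n"
      using e False by (auto simp: y_def dist_norm subset_iff)
    then have "norm (f (x0 + y)) \<le> real n" "norm (f x0) \<le> real n"
      using f by (auto simp: E_def)
    moreover have "f y = f (x0 + y) - f x0" by (simp add: f.add)
    ultimately have "norm (f y) \<le> 2 * real n"
      using norm_triangle_ineq4[of "f (x0 + y)" "f x0"] by simp
    moreover have "norm (f y) = e / norm x * norm (f x)"
      using e by (simp add: y_def f.scaleR)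
    ultimately show ?thesis using e False by (simp add: field_simps)
  qed
  then show ?thesis by (rule that)
qed

section \<open>Complex subspaces, orthogonal projection and Riesz representation\<close>

definition csubspace :: "'a::complex_inner set \<Rightarrow> bool" where
  "csubspace S \<longleftrightarrow> 0 \<in> S \<and> (\<forall>x\<in>S. \<forall>y\<in>S. x + y \<in> S) \<and> (\<forall>c. \<forall>x\<in>S. c *\<^sub>C x \<in> S)"

lemma bounded_linear_scaleC: "bounded_linear (\<lambda>x::'a::complex_inner. c *\<^sub>C x)"
proof (rule bounded_linear_intro[where K = "cmod c"])
  show "c *\<^sub>C (r *\<^sub>R x) = r *\<^sub>R (c *\<^sub>C x)" for r and x :: 'a
    by (simp add: scaleR_scaleC scaleC_scaleC mult.commute)
qed (auto simp: scaleC_add_right norm_scaleC)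

lemma csubspace_closure:
  assumes "csubspace S"
  shows "csubspace (closure S)"
  unfolding csubspace_def
proof (intro conjI ballI allI)
  show "0 \<in> closure S"
    using assms closure_subset by (auto simp: csubspace_def)
next
  fix x y assume "x \<in> closure S" "y \<in> closure S"
  then obtain f g where "\<And>n::nat. f n \<in> S" "f \<longlonglongrightarrow> x" "\<And>n::nat. g n \<in> S" "g \<longlonglongrightarrow> y"
    by (auto simp: closure_sequential)
  then have "\<And>n. f n + g n \<in> S" "(\<lambda>n. f n + g n) \<longlonglongrightarrow> x + y"
    using assms by (auto simp: csubspace_def intro: tendsto_add)
  then show "x + y \<in> closure S"
    unfolding closure_sequential by (intro exI[of _ "\<lambda>n. f n + g n"]) auto
next
  fix c x assume "x \<in> closure S"
  then obtain f where "\<And>n::nat. f n \<in> S" "f \<longlonglongrightarrow> x"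
    by (auto simp: closure_sequential)
  then have "\<And>n. c *\<^sub>C f n \<in> S" "(\<lambda>n. c *\<^sub>C f n) \<longlonglongrightarrow> c *\<^sub>C x"
    using assms by (auto simp: csubspace_def intro: bounded_linear.tendsto[OF bounded_linear_scaleC])
  then show "c *\<^sub>C x \<in> closure S"
    unfolding closure_sequential by (intro exI[of _ "\<lambda>n. c *\<^sub>C f n"]) auto
qed

lemma csubspace_diff: "csubspace S \<Longrightarrow> x \<in> S \<Longrightarrow> y \<in> S \<Longrightarrow> x - y \<in> S"
  unfolding csubspace_def
  by (metis diff_conv_add_uminus of_real_1 of_real_minus scaleR_minus1_left scaleR_scaleC)

lemma csubspace_range:
  assumes "bounded_clinear T"
  shows "csubspace (range T)"
  unfolding csubspace_def
proof (intro conjI ballI allI)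
  show "0 \<in> range T"
    using rangeI[of T 0] by (simp add: bounded_clinearD(6)[OF assms])
  fix x assume "x \<in> range T"
  then obtain u where u: "x = T u" by blast
  show "c *\<^sub>C x \<in> range T" for c
    using rangeI[of T "c *\<^sub>C u"] by (simp add: u bounded_clinearD(4)[OF assms])
  fix y assume "y \<in> range T"
  then obtain v where v: "y = T v" by blast
  show "x + y \<in> range T"
    using rangeI[of T "u + v"] by (simp add: u v bounded_clinearD(2)[OF assms])
qed

text \<open>A minimising sequence for the distance from \<open>x\<close> to \<open>S\<close> is
  Cauchy by the parallelogram law; at its limit, varying along \<open>t\<close> in \<open>S\<close>
  gives orthogonality.\<close>

lemma orthogonal_projection_exists:
  fixes S :: "'a::chilbert_space set"
  assumes clo: "closed S" and sub: "csubspace S"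
  shows "\<exists>p\<in>S. \<forall>s\<in>S. cinner (x - p) s = 0"
proof -
  define d where "d = (INF s\<in>S. (norm (x - s))\<^sup>2)"
  have S0: "S \<noteq> {}" using sub by (auto simp: csubspace_def)
  have bdd: "bdd_below ((\<lambda>s. (norm (x - s))\<^sup>2) ` S)"
    by (rule bdd_belowI2[of _ 0]) simp
  have d_le: "d \<le> (norm (x - s))\<^sup>2" if "s \<in> S" for s
    unfolding d_def by (rule cINF_lower[OF bdd that])
  have "\<exists>s\<in>S. (norm (x - s))\<^sup>2 < d + inverse (real (Suc n))" for n
    using cINF_less_iff[OF S0 bdd, of "d + inverse (real (Suc n))"] by (simp add: d_def)
  then obtain s where s: "\<And>n. s n \<in> S" "\<And>n. (norm (x - s n))\<^sup>2 < d + inverse (real (Suc n))"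
    by metis
  have near: "(norm (s m - s n))\<^sup>2 \<le> 2 * inverse (real (Suc m)) + 2 * inverse (real (Suc n))"
    for m n
  proof -
    \<comment> \<open>The midpoint stays in \<open>S\<close>, so its squared distance from
      \<open>x\<close> is at least \<open>d\<close>; this bounds the sum term of the parallelogram
      law below by \<open>4 * d\<close>.\<close>
    have mid: "(1/2) *\<^sub>R (s m + s n) \<in> S"
      using sub s(1) by (auto simp: csubspace_def scaleR_scaleC)
    have "(x - s m) + (x - s n) = 2 *\<^sub>R (x - (1/2) *\<^sub>R (s m + s n))"
      by (simp add: algebra_simps flip: scaleR_2)
    then have "(norm ((x - s m) + (x - s n)))\<^sup>2 = 4 * (norm (x - (1/2) *\<^sub>R (s m + s n)))\<^sup>2"
      by (simp add: power_mult_distrib)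
    then have "4 * d \<le> (norm ((x - s m) + (x - s n)))\<^sup>2" using d_le[OF mid] by simp
    moreover have "(norm (s m - s n))\<^sup>2 = (norm ((x - s n) - (x - s m)))\<^sup>2" by simp
    ultimately show ?thesis
      using s(2)[of m] s(2)[of n] norm_diff_sq[of "x - s n" "x - s m"]
        norm_add_sq[of "x - s n" "x - s m"] by (simp add: add.commute)
  qed
  have "Cauchy s"
  proof (rule metric_CauchyI)
    fix e :: real assume "e > 0"
    then obtain N where N: "inverse (real (Suc N)) < e\<^sup>2 / 4"
      using reals_Archimedean[of "e\<^sup>2 / 4"] by auto
    show "\<exists>M. \<forall>m\<ge>M. \<forall>n\<ge>M. dist (s m) (s n) < e"
    proof (intro exI allI impI)
      fix m n assume mn: "m \<ge> N" "n \<ge> N"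
      then have "inverse (real (Suc m)) \<le> inverse (real (Suc N))"
        "inverse (real (Suc n)) \<le> inverse (real (Suc N))" by auto
      then have "(norm (s m - s n))\<^sup>2 < e\<^sup>2" using near[of m n] N by linarith
      then show "dist (s m) (s n) < e"
        using \<open>e > 0\<close> by (simp add: dist_norm power_less_imp_less_base)
    qed
  qed
  then obtain p where p: "s \<longlonglongrightarrow> p" using Cauchy_convergent convergent_def by blast
  have pS: "p \<in> S" using clo p s(1) by (metis closed_sequentially)
  have "(\<lambda>n. (norm (x - s n))\<^sup>2) \<longlonglongrightarrow> (norm (x - p))\<^sup>2"
    by (intro tendsto_intros p)
  moreover have "(\<lambda>n. d + inverse (real (Suc n))) \<longlonglongrightarrow> d + 0"
    by (intro tendsto_intros LIMSEQ_inverse_real_of_nat)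
  ultimately have "(norm (x - p))\<^sup>2 \<le> d + 0"
    by (rule LIMSEQ_le) (use s(2) less_imp_le in blast)
  then have pd: "(norm (x - p))\<^sup>2 \<le> d" by simp
  have "cinner (x - p) t = 0" if t: "t \<in> S" for t
  proof (cases "t = 0")
    case False
    define z where "z = cinner (x - p) t"
    \<comment> \<open>The minimising coefficient: moving by it lowers the squared distance by
      \<open>(cmod z)\<^sup>2 / (norm t)\<^sup>2\<close>, which minimality of \<open>p\<close>
      forbids unless \<open>z = 0\<close>.\<close>
    define c where "c = - z / of_real ((norm t)\<^sup>2)"
    have "p - c *\<^sub>C t \<in> S" using sub t by (intro csubspace_diff[OF sub pS]) (simp add: csubspace_def)
    note order_trans[OF pd d_le[OF this]]
    also have "x - (p - c *\<^sub>C t) = (x - p) + c *\<^sub>C t" by simp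
    finally have "(norm (x - p))\<^sup>2 \<le> (norm ((x - p) + c *\<^sub>C t))\<^sup>2" .
    also have "\<dots> = (norm (x - p))\<^sup>2 + 2 * Re (cnj c * z) + (cmod c)\<^sup>2 * (norm t)\<^sup>2"
      by (simp add: norm_add_sq cinner_scaleC_right z_def norm_scaleC power_mult_distrib)
    also have "cnj c * z = - of_real ((cmod z)\<^sup>2 / (norm t)\<^sup>2)"
      by (simp add: c_def mult.commute[of "cnj z"] flip: complex_norm_square of_real_power)
    also have "(cmod c)\<^sup>2 * (norm t)\<^sup>2 = (cmod z)\<^sup>2 / (norm t)\<^sup>2"
      using False by (simp add: c_def norm_divide power_divide field_simps norm_power)
    finally have "(cmod z)\<^sup>2 / (norm t)\<^sup>2 \<le> 0" by simp
    then show ?thesis using False by (simp add: z_def divide_le_0_iff)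
  qed simp
  with pS show ?thesis by blast
qed

text \<open>A nonzero \<open>z\<close> orthogonal to the closed kernel determines \<open>f\<close>,
  because \<open>f z *\<^sub>C x - f x *\<^sub>C z\<close> always lies in the kernel.\<close>

lemma Riesz_representation:
  fixes f :: "'a::chilbert_space \<Rightarrow> complex"
  assumes "bounded_linear f" and scale: "\<And>c x. f (c *\<^sub>C x) = c * f x"
  shows "\<exists>y. \<forall>x. f x = cinner x y"
proof (cases "\<forall>x. f x = 0")
  case True
  then show ?thesis by (intro exI[of _ 0]) simp
next
  case False
  interpret f: bounded_linear f by fact
  obtain x0 where x0: "f x0 \<noteq> 0" using False by blast
  have "closed {x. f x = 0}"
    by (intro closed_Collect_eq continuous_on_const linear_continuous_on assms)
  moreover have "csubspace {x. f x = 0}"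
    by (simp add: csubspace_def f.add f.zero scale)
  ultimately have "\<exists>p\<in>{x. f x = 0}. \<forall>s\<in>{x. f x = 0}. cinner (x0 - p) s = 0"
    by (rule orthogonal_projection_exists)
  then obtain p where p: "f p = 0" "\<And>s. f s = 0 \<Longrightarrow> cinner (x0 - p) s = 0" by auto
  define z where "z = x0 - p"
  have fz: "f z \<noteq> 0" using p x0 by (simp add: z_def f.diff)
  then have z0: "z \<noteq> 0" by (metis f.zero)
  \<comment> \<open>The coefficient is conjugated since \<open>cinner\<close> is conjugate-linear in
    its second argument.\<close>
  define y where "y = (cnj (f z) / of_real ((norm z)\<^sup>2)) *\<^sub>C z"
  have "f x = cinner x y" for x
  proof -
    have "f (f z *\<^sub>C x - f x *\<^sub>C z) = 0" by (simp add: f.diff scale)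
    from p(2)[OF this] have "cinner (f z *\<^sub>C x - f x *\<^sub>C z) z = 0"
      using cinner_commute[of _ z] by (simp add: z_def)
    then have "f z * cinner x z = f x * of_real ((norm z)\<^sup>2)"
      by (simp add: cinner_diff_left cinner_scaleC_left cinner_same)
    then show ?thesis using z0 by (simp add: y_def cinner_scaleC_right field_simps)
  qed
  then show ?thesis by blast
qed

text \<open>Riesz yields \<open>S y\<close> for each \<open>y\<close>. A vector is determined by its
  inner products, which gives linearity of \<open>S\<close> and the uniqueness that resolves the
  definite description.\<close>

lemma cadjoint:
  assumes T: "bounded_clinear T"
  shows bounded_clinear_cadjoint: "bounded_clinear (cadjoint T)"
    and cinner_cadjoint: "cinner (T x) y = cinner x (cadjoint T y)"
proof -
  have "\<exists>z. \<forall>x. cinner (T x) y = cinner x z" for y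
  proof -
    have "bounded_linear (\<lambda>x. cinner (T x) y)"
      using bounded_linear_compose[OF bounded_linear_cinner_left bounded_clinearD(1)[OF T]] .
    then show ?thesis
      by (rule Riesz_representation) (auto simp: bounded_clinearD[OF T] cinner_scaleC_left)
  qed
  then obtain S where S: "\<And>x y. cinner (T x) y = cinner x (S y)" by metis
  obtain K where K: "0 \<le> K" "\<And>x. norm (T x) \<le> norm x * K"
    using bounded_linear.nonneg_bounded[OF bounded_clinearD(1)[OF T]] by blast
  have bS: "bounded_clinear S"
  proof (rule bounded_clinearI)
    show "S (x + y) = S x + S y" for x y
      by (rule cinner_right_eqI) (simp add: cinner_add_right flip: S)
    show "S (c *\<^sub>C x) = c *\<^sub>C S x" for c x
      by (rule cinner_right_eqI) (simp add: cinner_scaleC_right flip: S)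
    show "norm (S y) \<le> K * norm y" for y
    proof (cases "S y = 0")
      case False
      \<comment> \<open>Testing the adjoint identity at \<open>x = S y\<close> bounds
        \<open>S\<close> by the constant of \<open>T\<close>.\<close>
      have "(norm (S y))\<^sup>2 = cmod (cinner (T (S y)) y)"
        by (simp add: S cinner_same norm_power)
      also have "\<dots> \<le> (norm (S y) * K) * norm y"
        using cinner_Cauchy_Schwarz K(2) by (meson mult_right_mono norm_ge_zero order_trans)
      finally show ?thesis using False by (simp add: power2_eq_square mult.assoc)
    qed (use K in auto)
  qed
  have "bounded_clinear (cadjoint T) \<and> (\<forall>x y. cinner (T x) y = cinner x (cadjoint T y))"
    unfolding cadjoint_def
  proof (rule theI[of _ S])
    show "bounded_clinear S \<and> (\<forall>x y. cinner (T x) y = cinner x (S y))"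
      using bS S by blast
    show "S' = S" if "bounded_clinear S' \<and> (\<forall>x y. cinner (T x) y = cinner x (S' y))" for S'
      using that S by (metis cinner_right_eqI ext)
  qed
  then show "bounded_clinear (cadjoint T)" "cinner (T x) y = cinner x (cadjoint T y)"
    by blast+
qed


section \<open>The \<open>A\<close>-adjoint\<close>

text \<open>By self-adjointness \<open>z - w\<close>, lying in the kernel of \<open>A\<close>, is
  orthogonal to \<open>range A\<close> and hence to its closure, which contains it.\<close>

lemma inj_on_closure_range:
  assumes A: "positive_operator A" and zw: "A z = A w"
    and "z \<in> closure (range A)" "w \<in> closure (range A)"
  shows "z = w"
proof -
  have "z - w \<in> closure (range A)"
    by (intro csubspace_diff csubspace_closure csubspace_range positive_operatorD(1) assms)
  moreover have "closed {u. cinner (z - w) u = 0}"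
    by (intro closed_Collect_eq continuous_on_const
        linear_continuous_on[OF bounded_linear_cinner_right])
  moreover have "range A \<subseteq> {u. cinner (z - w) u = 0}"
    using zw by (auto simp: cinner_diff_left simp flip: positive_operator_selfadjoint[OF A])
  ultimately have "cinner (z - w) (z - w) = 0"
    using closure_minimal by blast
  then show ?thesis by simp
qed

text \<open>\<open>X y\<close> is a preimage of \<open>cadjoint T (A y)\<close> under
  \<open>A\<close>, projected to the closed range. Injectivity of \<open>A\<close> there makes
  \<open>X\<close> linear and unique; its boundedness comes from uniform boundedness.\<close>

lemma A_sharp:
  fixes A T :: "'a::chilbert_space \<Rightarrow> 'a"
  assumes A: "positive_operator A" and T: "T \<in> A_adjointable A"
  shows bounded_clinear_A_sharp: "bounded_clinear (A_sharp A T)"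
    and A_sharp_eq: "A (A_sharp A T y) = cadjoint T (A y)"
proof -
  let ?R = "closure (range A)"
  note bA = positive_operatorD(1)[OF A]
  have bT: "bounded_clinear T" and ran: "range (cadjoint T \<circ> A) \<subseteq> range A"
    using T by (auto simp: A_adjointable_def)
  note bT' = bounded_clinear_cadjoint[OF bT]
  have subR: "csubspace ?R" by (intro csubspace_closure csubspace_range bA)
  have "\<exists>z\<in>?R. A z = cadjoint T (A y)" for y
  proof -
    have "cadjoint T (A y) \<in> range A" using ran by auto
    then obtain w where w: "A w = cadjoint T (A y)" by (metis imageE)
    \<comment> \<open>Projecting does not change the image: \<open>w - p\<close> is orthogonal to
      \<open>range A\<close>, so \<open>A\<close> kills it.\<close>
    obtain p where p: "p \<in> ?R" "\<And>s. s \<in> ?R \<Longrightarrow> cinner (w - p) s = 0"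
      using orthogonal_projection_exists[OF closed_closure subR, of w] by blast
    have "cinner (A (w - p)) v = cinner 0 v" for v
      using p(2)[of "A v"] closure_subset[of "range A"]
      by (auto simp: positive_operator_selfadjoint[OF A])
    then have "A (w - p) = 0" by (rule cinner_left_eqI)
    then show ?thesis using w p(1) bounded_clinearD[OF bA] by auto
  qed
  then obtain X where XR: "\<And>y. X y \<in> ?R" and AX: "\<And>y. A (X y) = cadjoint T (A y)" by metis
  define F where "F = {\<lambda>y. cinner y (A (T w)) | w. norm (A w) \<le> 1}"
  \<comment> \<open>\<open>A (T w)\<close> acts as a formal adjoint of \<open>X\<close> at \<open>A w\<close>, so the functionals in \<open>F\<close> are
    pointwise bounded by \<open>norm (X y)\<close>.\<close>
  have formal: "cinner y (A (T w)) = cinner (X y) (A w)" for y w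
  proof -
    have "cinner y (A (T w)) = cnj (cinner (T w) (A y))"
      by (metis cinner_commute positive_operator_selfadjoint[OF A])
    also have "\<dots> = cinner (A (X y)) w"
      by (simp add: cinner_cadjoint[OF bT] AX cinner_commute[of _ w])
    finally show ?thesis by (simp add: positive_operator_selfadjoint[OF A])
  qed
  have "bounded_linear f" if "f \<in> F" for f
    using that by (auto simp: F_def bounded_linear_cinner_left)
  moreover have "\<exists>K. \<forall>f\<in>F. norm (f y) \<le> K" for y
  proof (intro exI ballI)
    fix f assume "f \<in> F"
    then obtain w where w: "f = (\<lambda>y. cinner y (A (T w)))" "norm (A w) \<le> 1"
      by (auto simp: F_def)
    have "norm (f y) \<le> norm (X y) * norm (A w)"
      by (simp add: w formal cinner_Cauchy_Schwarz)
    also have "\<dots> \<le> norm (X y)" using w by (simp add: mult_left_le)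
    finally show "norm (f y) \<le> norm (X y)" .
  qed
  ultimately obtain K where K: "\<And>f y. f \<in> F \<Longrightarrow> norm (f y) \<le> K * norm y"
    using uniform_boundedness[of F] by blast
  \<comment> \<open>Homogeneity carries the bound from \<open>norm (A w) \<le> 1\<close> to the
    whole range.\<close>
  have K': "cmod (cinner (X y) u) \<le> K * norm y * norm u" if u: "u \<in> range A" for y u
  proof (cases "u = 0")
    case False
    obtain w where w: "u = A w" using u by blast
    have "A ((1 / norm u) *\<^sub>R w) = (1 / norm u) *\<^sub>R u"
      by (simp add: w bounded_clinearD[OF bA])
    then have "norm (A ((1 / norm u) *\<^sub>R w)) \<le> 1"
      "cinner (X y) (A ((1 / norm u) *\<^sub>R w)) = of_real (1 / norm u) * cinner (X y) u"
      using False by (simp_all only: cinner_scaleR_right) simp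
    moreover from this(1) have "cmod (cinner y (A (T ((1 / norm u) *\<^sub>R w)))) \<le> K * norm y"
      by (intro K) (auto simp: F_def)
    ultimately have "cmod (cinner (X y) u) / norm u \<le> K * norm y"
      by (simp add: formal norm_mult norm_divide)
    then show ?thesis using False by (simp add: field_simps)
  qed simp
  have bound: "norm (X y) \<le> K * norm y" for y
  proof (cases "X y = 0")
    case True
    show ?thesis
    proof (cases "y = 0")
      case False
      \<comment> \<open>The sign of \<open>K\<close> is not supplied by
        \<open>uniform_boundedness\<close>; the zero functional, obtained from \<open>w = 0\<close>,
        gives \<open>0 \<le> K * norm y\<close>.\<close>
      have "(\<lambda>y. cinner y (A (T 0))) \<in> F"
        using bounded_clinearD(6)[OF bA] by (force simp: F_def)
      from order_trans[OF norm_ge_zero K[OF this, of y]] True show ?thesis by simp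
    qed (use True in simp)
  next
    case False
    \<comment> \<open>The estimate is a closed condition on \<open>u\<close>, so it passes to the
      closure of the range and may be used at \<open>u = X y\<close>.\<close>
    have "closed {u. cmod (cinner (X y) u) \<le> K * norm y * norm u}"
      by (intro closed_Collect_le continuous_intros
          linear_continuous_on[OF bounded_linear_cinner_right])
    moreover have "range A \<subseteq> {u. cmod (cinner (X y) u) \<le> K * norm y * norm u}"
      using K' by blast
    ultimately have "cmod (cinner (X y) (X y)) \<le> K * norm y * norm (X y)"
      using XR closure_minimal by blast
    then show ?thesis using False by (simp add: cinner_same norm_mult power2_eq_square)
  qed
  have bX: "bounded_clinear X"
  proof (rule bounded_clinearI[OF _ _ bound])
    show "X (x + y) = X x + X y" for x y
      by (rule inj_on_closure_range[OF A])
        (use XR subR in \<open>auto simp: AX bounded_clinearD[OF bA] bounded_clinearD[OF bT'] csubspace_def\<close>)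
    show "X (c *\<^sub>C x) = c *\<^sub>C X x" for c x
      by (rule inj_on_closure_range[OF A])
        (use XR subR in \<open>auto simp: AX bounded_clinearD[OF bA] bounded_clinearD[OF bT'] csubspace_def\<close>)
  qed
  have "bounded_clinear (A_sharp A T) \<and> A \<circ> A_sharp A T = cadjoint T \<circ> A
      \<and> range (A_sharp A T) \<subseteq> ?R"
    unfolding A_sharp_def
  proof (rule theI[of _ X])
    show "bounded_clinear X \<and> A \<circ> X = cadjoint T \<circ> A \<and> range X \<subseteq> ?R"
      using bX AX XR by auto
    show "X' = X" if X': "bounded_clinear X' \<and> A \<circ> X' = cadjoint T \<circ> A \<and> range X' \<subseteq> ?R" for X'
    proof
      fix y
      have "(A \<circ> X') y = (cadjoint T \<circ> A) y" using X' by simp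
      then have "A (X' y) = A (X y)" by (simp add: AX)
      moreover have "X' y \<in> ?R" using X' by blast
      ultimately show "X' y = X y" by (rule inj_on_closure_range[OF A _ _ XR])
    qed
  qed
  then have sharp: "bounded_clinear (A_sharp A T)" "A \<circ> A_sharp A T = cadjoint T \<circ> A"
    by blast+
  show "bounded_clinear (A_sharp A T)" by (rule sharp)
  show "A (A_sharp A T y) = cadjoint T (A y)" using fun_cong[OF sharp(2), of y] by simp
qed

lemma A_inner_A_sharp:
  assumes "positive_operator A" "T \<in> A_adjointable A"
  shows "A_inner A (A_sharp A T x) y = A_inner A x (T y)"
proof -
  have "bounded_clinear T" using assms by (simp add: A_adjointable_def)
  then show ?thesis
    unfolding A_inner_def A_sharp_eq[OF assms]
    by (metis cinner_cadjoint cinner_commute)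
qed

text \<open>Krein's argument: with \<open>b n = A_norm A ((B ^^ n) x)\<close>, symmetry and Cauchy--Schwarz give
  \<open>(b n)\<^sup>2 \<le> b (2 * n)\<close>, hence \<open>(b 1) ^ (2 ^ k) \<le> b (2 ^ k) = O(K ^ (2 ^ k))\<close>, so that
  \<open>b 1 \<le> K\<close>.\<close>

lemma A_norm_symmetric_bounded:
  assumes A: "positive_operator A" and B: "bounded_clinear B"
    and sym: "\<And>x y. A_inner A (B x) y = A_inner A x (B y)"
  obtains K where "\<And>x. A_norm A x = 1 \<Longrightarrow> A_norm A (B x) \<le> K"
proof -
  obtain K where K: "0 < K" "\<And>x. norm (B x) \<le> norm x * K"
    using bounded_linear.pos_bounded[OF bounded_clinearD(1)[OF B]] by blast
  obtain C where C: "0 \<le> C" "\<And>x. A_norm A x \<le> C * norm x"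
    using A_norm_le_norm[OF A] by blast
  have sym_pow: "A_inner A ((B ^^ n) x) y = A_inner A x ((B ^^ n) y)" for n x y
    by (induction n arbitrary: x y) (simp_all add: sym funpow_swap1)
  have norm_pow: "norm ((B ^^ n) x) \<le> K ^ n * norm x" for n x
  proof (induction n)
    case (Suc n)
    have "norm ((B ^^ Suc n) x) \<le> norm ((B ^^ n) x) * K" using K by simp
    also have "\<dots> \<le> (K ^ n * norm x) * K" using Suc K by (intro mult_right_mono) auto
    finally show ?case by (simp add: mult_ac)
  qed simp
  have "A_norm A (B x) \<le> K" if x: "A_norm A x = 1" for x
  proof (rule ccontr)
    define b where "b = (\<lambda>n. A_norm A ((B ^^ n) x))"
    have b0: "0 \<le> b n" for n using A by (simp add: b_def)
    have double: "(b n)\<^sup>2 \<le> b (2 * n)" for n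
    proof -
      have "(b n)\<^sup>2 = Re (A_inner A x ((B ^^ (2 * n)) x))"
        unfolding b_def A_norm_sq[OF A] sym_pow by (simp add: mult_2 funpow_add)
      also have "\<dots> \<le> A_norm A x * b (2 * n)"
        unfolding b_def using A_inner_Cauchy_Schwarz[OF A] complex_Re_le_cmod order_trans by blast
      finally show ?thesis by (simp add: x)
    qed
    have pow: "b 1 ^ (2 ^ k) \<le> b (2 ^ k)" for k
    proof (induction k)
      case (Suc k)
      have "b 1 ^ (2 ^ Suc k) = (b 1 ^ (2 ^ k))\<^sup>2" by (simp add: mult.commute flip: power_mult)
      also have "\<dots> \<le> (b (2 ^ k))\<^sup>2" using Suc b0 by (intro power_mono) auto
      also have "\<dots> \<le> b (2 * 2 ^ k)" by (rule double)
      finally show ?case by simp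
    qed simp
    assume "\<not> A_norm A (B x) \<le> K"
    then have gt: "1 < b 1 / K" using K by (simp add: b_def)
    \<comment> \<open>Powers of a ratio above 1 are unbounded, while those with exponent a power of
      two are at most \<open>C * norm x\<close>; hence the passage from \<open>n\<close> to
      \<open>2 ^ n\<close>.\<close>
    obtain n where n: "C * norm x < (b 1 / K) ^ n" using real_arch_pow[OF gt] by blast
    have "(b 1 / K) ^ n \<le> (b 1 / K) ^ (2 ^ n)"
      using gt by (intro power_increasing) (auto simp: less_imp_le)
    also have "\<dots> \<le> b (2 ^ n) / K ^ (2 ^ n)"
      using pow[of n] K by (simp add: power_divide divide_right_mono)
    also have "\<dots> \<le> C * (K ^ (2 ^ n) * norm x) / K ^ (2 ^ n)"
      unfolding b_def using K C norm_pow
      by (intro divide_right_mono order_trans[OF C(2)] mult_left_mono) auto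
    also have "\<dots> = C * norm x" using K by simp
    finally show False using n by simp
  qed
  then show ?thesis by (rule that)
qed

text \<open>Links the numerical radius of \<open>A_sharp A T \<circ> T\<close> to the values
  \<open>A_norm A (T x)\<close>, which is how it enters the final maximum.\<close>

lemma A_norm_sq_image:
  assumes "positive_operator A" "T \<in> A_adjointable A"
  shows "A_inner A ((A_sharp A T \<circ> T) x) x = of_real ((A_norm A (T x))\<^sup>2)"
  by (simp add: A_inner_A_sharp assms A_inner_same del: of_real_power)

text \<open>\<open>T\<close> may fail to be symmetric, so Krein's bound is applied to
  \<open>A_sharp A T \<circ> T\<close>, whose quadratic form is the squared seminorm of
  \<open>T x\<close>.\<close>

lemma A_adjointable_A_bounded:
  assumes A: "positive_operator A" and T: "T \<in> A_adjointable A"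
  obtains K where "\<And>x. A_norm A x = 1 \<Longrightarrow> A_norm A (T x) \<le> K"
proof -
  let ?B = "A_sharp A T \<circ> T"
  have bT: "bounded_clinear T" using T by (simp add: A_adjointable_def)
  have "A_inner A (?B x) y = A_inner A x (?B y)" for x y
    using A_inner_commute[OF A] by (metis A_inner_A_sharp[OF A T] comp_apply)
  then obtain K where K: "\<And>x. A_norm A x = 1 \<Longrightarrow> A_norm A (?B x) \<le> K"
    using A_norm_symmetric_bounded[OF A bounded_clinear_compose[OF bounded_clinear_A_sharp[OF A T] bT]]
    by blast
  have "A_norm A (T x) \<le> sqrt K" if x: "A_norm A x = 1" for x
  proof -
    have "(A_norm A (T x))\<^sup>2 = cmod (A_inner A (?B x) x)"
      unfolding A_norm_sq_image[OF A T] norm_of_real by simp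
    also have "\<dots> \<le> A_norm A (?B x) * A_norm A x" by (rule A_inner_Cauchy_Schwarz[OF A])
    also have "\<dots> \<le> K" using K[OF x] x by simp
    finally show ?thesis by (rule real_le_rsqrt)
  qed
  then show ?thesis by (rule that)
qed


section \<open>The Davis--Wielandt radius\<close>

text \<open>In the expanded squared seminorm of the combination of \<open>y\<close> and
  \<open>z\<close>, both coefficients are bounded by their maximum \<open>M\<close>, so one factor
  \<open>M\<close> leaves the square root.\<close>

lemma A_inner_sum_sq_le:
  assumes A: "positive_operator A"
  shows "(cmod (A_inner A u y))\<^sup>2 + (cmod (A_inner A u z))\<^sup>2
    \<le> A_norm A u * max (cmod (A_inner A u y)) (cmod (A_inner A u z))
      * sqrt ((A_norm A y)\<^sup>2 + (A_norm A z)\<^sup>2 + 2 * cmod (A_inner A y z))"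
proof -
  define \<alpha> \<beta> where "\<alpha> = A_inner A u y" and "\<beta> = A_inner A u z"
  define M where "M = max (cmod \<alpha>) (cmod \<beta>)"
  let ?v = "\<alpha> *\<^sub>C y + \<beta> *\<^sub>C z"
  let ?s = "(A_norm A y)\<^sup>2 + (A_norm A z)\<^sup>2 + 2 * cmod (A_inner A y z)"
  have M: "cmod \<alpha> \<le> M" "cmod \<beta> \<le> M" "0 \<le> M" by (auto simp: M_def le_max_iff_disj)
  have "A_inner A u ?v = of_real ((cmod \<alpha>)\<^sup>2 + (cmod \<beta>)\<^sup>2)"
    unfolding A_inner_add_right A_inner_scaleC_right \<alpha>_def[symmetric] \<beta>_def[symmetric]
    by (simp only: of_real_add complex_norm_square mult.commute)
  then have "(cmod \<alpha>)\<^sup>2 + (cmod \<beta>)\<^sup>2 \<le> A_norm A u * A_norm A ?v"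
    using A_inner_Cauchy_Schwarz[OF A, of u ?v] by (simp only: norm_of_real)
  also have "A_norm A ?v \<le> M * sqrt ?s"
  proof -
    have "Re (A_inner A (\<alpha> *\<^sub>C y) (\<beta> *\<^sub>C z)) \<le> cmod \<alpha> * cmod \<beta> * cmod (A_inner A y z)"
      using complex_Re_le_cmod[of "A_inner A (\<alpha> *\<^sub>C y) (\<beta> *\<^sub>C z)"]
      by (simp add: A_inner_scaleC_left[OF A] A_inner_scaleC_right norm_mult mult_ac)
    also have "\<dots> \<le> M\<^sup>2 * cmod (A_inner A y z)"
      unfolding power2_eq_square using M by (intro mult_right_mono mult_mono) auto
    finally have "Re (A_inner A (\<alpha> *\<^sub>C y) (\<beta> *\<^sub>C z)) \<le> M\<^sup>2 * cmod (A_inner A y z)" .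
    moreover have "(cmod \<alpha>)\<^sup>2 * (A_norm A y)\<^sup>2 \<le> M\<^sup>2 * (A_norm A y)\<^sup>2"
      "(cmod \<beta>)\<^sup>2 * (A_norm A z)\<^sup>2 \<le> M\<^sup>2 * (A_norm A z)\<^sup>2"
      using M by (intro mult_right_mono power_mono; simp)+
    ultimately have "(A_norm A ?v)\<^sup>2 \<le> M\<^sup>2 * ?s"
      by (simp add: A_norm_add_sq[OF A] A_norm_scaleC[OF A] power_mult_distrib distrib_left)
    then have "A_norm A ?v \<le> sqrt (M\<^sup>2 * ?s)" by (rule real_le_rsqrt)
    then show ?thesis using M by (simp add: real_sqrt_mult)
  qed
  finally show ?thesis
    using A by (simp add: M_def \<alpha>_def \<beta>_def mult_left_mono mult.assoc)
qed

text \<open>If \<open>w\<close> had seminorm 0, Cauchy--Schwarz against \<open>A w\<close> would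
  force \<open>A w = 0\<close>; otherwise \<open>w\<close> can be normalised.\<close>

lemma A_norm_unit_exists:
  assumes A: "positive_operator A" and "A \<noteq> (\<lambda>x. 0)"
  obtains x where "A_norm A x = 1"
proof -
  obtain w where w: "A w \<noteq> 0" using assms by (auto simp: fun_eq_iff)
  have "A_norm A w \<noteq> 0"
  proof
    assume "A_norm A w = 0"
    then have "cinner (A w) (A w) = 0"
      using A_inner_Cauchy_Schwarz[OF A, of w "A w"] by (simp add: A_inner_def)
    with w show False by simp
  qed
  then have "A_norm A (complex_of_real (1 / A_norm A w) *\<^sub>C w) = 1"
    using A by (simp add: A_norm_scaleC norm_divide)
  then show ?thesis by (rule that)
qed

theorem theorem2p6:
  fixes A T :: "'a::chilbert_space \<Rightarrow> 'a"
  assumes "positive_operator A"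
    and "A \<noteq> (\<lambda>x. 0)"
    and "T \<in> A_adjointable A"
  shows "A_DW_radius A T \<le>
    sqrt (A_opnorm A T
      * max (A_numerical_radius A T) (A_numerical_radius A (A_sharp A T \<circ> T))
      * sqrt (1 + (A_opnorm A T)\<^sup>2 + 2 * A_numerical_radius A T))"
proof -
  note A = assms(1) and T = assms(3)
  let ?U = "{x. A_norm A x = 1}" and ?N = "A_opnorm A T" and ?w = "A_numerical_radius A T"
    and ?w' = "A_numerical_radius A (A_sharp A T \<circ> T)"
  \<comment> \<open>\<open>K\<close>, or its square, bounds the three sets whose suprema occur on
    the right, so each supremum dominates its members.\<close>
  obtain K where K: "\<And>x. A_norm A x = 1 \<Longrightarrow> A_norm A (T x) \<le> K"
    using A_adjointable_A_bounded[OF A T] by blast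
  have N: "A_norm A (T x) \<le> ?N" if "A_norm A x = 1" for x
    unfolding A_opnorm_def using that K by (intro cSUP_upper bdd_aboveI2[where M = K]) auto
  have w: "cmod (A_inner A (T x) x) \<le> ?w" if "A_norm A x = 1" for x
    unfolding A_numerical_radius_def
  proof (intro cSUP_upper bdd_aboveI2)
    show "cmod (A_inner A (T y) y) \<le> K" if "y \<in> ?U" for y
      using A_inner_Cauchy_Schwarz[OF A, of "T y" y] K[of y] that by simp
  qed (use that in simp)
  have w': "(A_norm A (T x))\<^sup>2 \<le> ?w'" if "A_norm A x = 1" for x
  proof -
    have "cmod (A_inner A ((A_sharp A T \<circ> T) x) x) \<le> ?w'"
      unfolding A_numerical_radius_def
    proof (intro cSUP_upper bdd_aboveI2)
      show "cmod (A_inner A ((A_sharp A T \<circ> T) y) y) \<le> K\<^sup>2" if "y \<in> ?U" for y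
        unfolding A_norm_sq_image[OF A T] norm_of_real using K[of y] that A by (simp add: power_mono)
    qed (use that in simp)
    then show ?thesis unfolding A_norm_sq_image[OF A T] norm_of_real by simp
  qed
  show ?thesis
    unfolding A_DW_radius_def
  proof (rule cSUP_least)
    show "?U \<noteq> {}" using A_norm_unit_exists[OF A assms(2)] by blast
  next
    fix x assume "x \<in> ?U"
    then have x: "A_norm A x = 1" by simp
    \<comment> \<open>A real supremum gets its sign from a member; the monotone product estimate
      uses it.\<close>
    have N0: "0 \<le> ?N" using N[OF x] A_norm_nonneg[OF A, of "T x"] by linarith
    have TT: "cmod (A_inner A (T x) (T x)) = (A_norm A (T x))\<^sup>2"
      by (simp add: A_inner_same[OF A] del: of_real_power)
    \<comment> \<open>Here \<open>u = z = T x\<close> and \<open>y = x\<close>. By \<open>TT\<close>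
      the second inner product has modulus \<open>(A_norm A (T x))\<^sup>2\<close>, whose square is
      the fourth power.\<close>
    have "(cmod (A_inner A (T x) x))\<^sup>2 + (A_norm A (T x)) ^ 4
        \<le> A_norm A (T x) * max (cmod (A_inner A (T x) x)) ((A_norm A (T x))\<^sup>2)
          * sqrt (1 + (A_norm A (T x))\<^sup>2 + 2 * cmod (A_inner A (T x) x))"
      using A_inner_sum_sq_le[OF A, of "T x" x "T x"] A_inner_commute[OF A, of x "T x"]
      by (simp add: TT x)
    also have "\<dots> \<le> ?N * max ?w ?w' * sqrt (1 + ?N\<^sup>2 + 2 * ?w)"
      using N[OF x] w[OF x] w'[OF x] N0 A
      by (intro mult_mono max.mono real_sqrt_le_mono add_mono power_mono order_refl
          mult_nonneg_nonneg) (auto simp: le_max_iff_disj intro: order_trans[OF norm_ge_zero])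
    finally show "sqrt ((cmod (A_inner A (T x) x))\<^sup>2 + A_norm A (T x) ^ 4)
        \<le> sqrt (?N * max ?w ?w' * sqrt (1 + ?N\<^sup>2 + 2 * ?w))"
      by (rule real_sqrt_le_mono)
  qed
qed

end
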